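(* Let $d,k$ be positive integers. Then \[ s(d,k) \le k\,(d+1)\,\frac{(s_d-1)^2}{d!}. \]
   Context: A lattice polytope in $\mathbb{R}^d$ is a polytope all of whose vertices lie in $\mathbb{Z}^d$. For positive integers $d,k$, $\mathcal{S}^d(k)$ denotes the family of all $d$-dimensional lattice simplices in $\mathbb{R}^d$ having exactly $k$ interior lattice points (points of $\mathbb{Z}^d$ in the interior), and $s(d,k) := \max\{\operatorname{vol}(S) : S \in \mathcal{S}^d(k)\}$, where $\operatorname{vol}$ is Lebesgue measure normalized so that $\operatorname{vol}([0,1]^d)=1$. The Sylvester sequence is defined by $s_1 := 2$ and $s_i := 1 + s_1 s_2 \cdots s_{i-1}$ for $i \ge 2$. *)

theory Defs
  imports "HOL-Analysis.Analysis"
begin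

definition lattice_point :: "real^'n \<Rightarrow> bool" where
  "lattice_point x \<longleftrightarrow> (\<forall>i. x $ i \<in> \<int>)"

definition lattice_simplex :: "(real^'n) set \<Rightarrow> bool" where
  "lattice_simplex S \<longleftrightarrow> (\<exists>V. finite V \<and> card V = CARD('n) + 1 \<and>
       \<not> affine_dependent V \<and> (\<forall>v\<in>V. lattice_point v) \<and> S = convex hull V)"

definition simplices_with_interior_points :: "nat \<Rightarrow> (real^'n) set set" where
  "simplices_with_interior_points k =
     {S. lattice_simplex S \<and> card {x \<in> interior S. lattice_point x} = k}"

(* Sylvester sequence: sylv_prod n = s_1 * ... * s_n, sylvester i = 1 + s_1 ... s_(i-1) *)
fun sylv_prod :: "nat \<Rightarrow> nat" where
  "sylv_prod 0 = 1"
| "sylv_prod (Suc n) = sylv_prod n * (1 + sylv_prod n)"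

definition sylvester :: "nat \<Rightarrow> nat" where
  "sylvester i = 1 + sylv_prod (i - 1)"

lemma sylvester_1: "sylvester 1 = 2" by (simp add: sylvester_def)

end

theory Submission
  imports Defs
begin

text \<open>
  Among the interior lattice points choose \<open>x\<close> whose smallest barycentric coordinate \<open>\<epsilon>\<close> is
  as large as possible and, subject to this, whose norm is as large as possible. Let
  \<open>\<beta>\<^sub>1 \<ge> \<dots> \<ge> \<beta>\<^sub>d\<close> be the other barycentric coordinates of \<open>x\<close>, and \<open>v\<^sub>i\<close> the corresponding vertices.

  Blichfeldt's principle for the parallelepiped with edges \<open>\<beta>\<^sub>i (v\<^sub>i - v\<^sub>0)\<close> gives
  \<open>d! vol(S) \<beta>\<^sub>1 \<cdots> \<beta>\<^sub>d \<le> k\<close>: otherwise it yields \<open>k + 1\<close> interior lattice points.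
  Blichfeldt's principle for integer combinations of \<open>v\<^sub>1 - x, \<dots>, v\<^sub>j - x\<close> gives
  \<open>(\<beta>\<^sub>1 - \<epsilon>) \<cdots> (\<beta>\<^sub>j - \<epsilon>) \<le> 1 - \<beta>\<^sub>1 - \<dots> - \<beta>\<^sub>j\<close>: otherwise \<open>x\<close> can be moved to an interior lattice
  point that contradicts its extremal choice.

  By an argument of Soundararajan on Egyptian fractions, the latter inequalities bound the partial
  sums of \<open>\<beta>\<^sub>i - \<epsilon>\<close> by those of \<open>1 / s\<^sub>i\<close>, and a weighted AM-GM inequality turns this into
  \<open>(d + 1) \<beta>\<^sub>1 \<cdots> \<beta>\<^sub>d \<ge> 1 / (s\<^sub>d - 1)\<^sup>2\<close>.
\<close>

section \<open>Inequalities for the Sylvester sequence\<close>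

text \<open>Abel summation, done by induction from the top: lowering the weight of a nonpositive
  tail from \<open>w (Suc j)\<close> to \<open>w j\<close> can only raise the sum.\<close>

lemma sum_mult_mono_tail_le:
  fixes w D :: "nat \<Rightarrow> real"
  assumes w: "\<And>i. i < n \<Longrightarrow> w i \<le> w (Suc i)"
    and D: "\<And>j. j \<le> n \<Longrightarrow> (\<Sum>i=j..n. D i) \<le> 0"
    and "j \<le> n"
  shows "(\<Sum>i=j..n. w i * D i) \<le> w j * (\<Sum>i=j..n. D i)"
  using \<open>j \<le> n\<close>
proof (induction j rule: inc_induct)
  case base
  then show ?case by simp
next
  case (step j)
  have "(\<Sum>i=j..n. w i * D i) = w j * D j + (\<Sum>i=Suc j..n. w i * D i)"
    using step.hyps by (simp add: sum.atLeast_Suc_atMost)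
  also have "\<dots> \<le> w j * D j + w (Suc j) * (\<Sum>i=Suc j..n. D i)"
    using step.IH by simp
  also have "\<dots> \<le> w j * D j + w j * (\<Sum>i=Suc j..n. D i)"
    using w[of j] D[of "Suc j"] step.hyps by (simp add: mult_right_mono_neg)
  also have "\<dots> = w j * (\<Sum>i=j..n. D i)"
    using step.hyps by (simp add: sum.atLeast_Suc_atMost algebra_simps)
  finally show ?case .
qed

text \<open>Weighted AM-GM. The weights \<open>1 / u i\<close> increase, so Abel summation turns the
  tail comparison into the statement that the ratios \<open>c i / u i\<close> have average at most
  1. Then \<open>r \<le> exp (r - 1)\<close>, applied to each ratio \<open>r\<close>, bounds their
  product by 1.\<close>

lemma prod_le_prod_of_tail_sums_le:
  fixes u c :: "nat \<Rightarrow> real"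
  assumes u: "\<And>i. i \<le> n \<Longrightarrow> 0 < u i" and dec: "\<And>i. i < n \<Longrightarrow> u (Suc i) \<le> u i"
    and c: "\<And>i. i \<le> n \<Longrightarrow> 0 < c i"
    and tail: "\<And>j. j \<le> n \<Longrightarrow> (\<Sum>i=j..n. c i) \<le> (\<Sum>i=j..n. u i)"
  shows "(\<Prod>i\<le>n. c i) \<le> (\<Prod>i\<le>n. u i)"
proof -
  have "(\<Sum>i=0..n. (1 / u i) * (c i - u i)) \<le> (1 / u 0) * (\<Sum>i=0..n. c i - u i)"
    by (rule sum_mult_mono_tail_le) (use u dec tail in \<open>auto simp: sum_subtractf frac_le\<close>)
  also have "\<dots> \<le> 0"
    using u[of 0] tail[of 0] by (simp add: sum_subtractf divide_le_0_iff)
  finally have s0: "(\<Sum>i=0..n. (1 / u i) * (c i - u i)) \<le> 0" .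
  have s: "(\<Sum>i\<le>n. c i / u i - 1) \<le> 0"
  proof -
    have "(\<Sum>i\<le>n. c i / u i - 1) = (\<Sum>i=0..n. (1 / u i) * (c i - u i))"
      unfolding atLeast0AtMost using u by (intro sum.cong) (auto simp: field_simps less_imp_neq[symmetric])
    with s0 show ?thesis by simp
  qed
  have "(\<Prod>i\<le>n. c i / u i) \<le> (\<Prod>i\<le>n. exp (c i / u i - 1))"
  proof (rule prod_mono, intro conjI)
    fix i assume "i \<in> {..n}"
    then show "0 \<le> c i / u i" using u[of i] c[of i] by simp
    show "c i / u i \<le> exp (c i / u i - 1)"
      using exp_ge_add_one_self[of "c i / u i - 1"] by simp
  qed
  also have "\<dots> = exp (\<Sum>i\<le>n. c i / u i - 1)" by (simp add: exp_sum)
  also have "\<dots> \<le> 1" using s by simp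
  finally have "(\<Prod>i\<le>n. c i) / (\<Prod>i\<le>n. u i) \<le> 1" by (simp add: prod_dividef)
  moreover have "(\<Prod>i\<le>n. u i) > 0" using u by (intro prod_pos) auto
  ultimately show ?thesis by (simp only: divide_le_eq_1_pos)
qed

section \<open>Sylvester numbers and Soundararajan's inequality\<close>

lemma sylv_prod_pos: "0 < sylv_prod n"
  by (induction n) auto

text \<open>Telescopes because \<open>1 / p = 1 / (1 + p) + 1 / (p * (1 + p))\<close>. Indices start
  at 0: \<open>1 + sylv_prod i\<close> is \<open>sylvester (i + 1)\<close>.\<close>

lemma sum_inverse_sylvester:
  "(\<Sum>i<n. 1 / (1 + real (sylv_prod i))) = 1 - 1 / real (sylv_prod n)"
proof (induction n)
  case (Suc n)
  have "1 / p = 1 / (1 + p) + 1 / (p * (1 + p))" if "0 < p" for p :: real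
    using that by (simp add: divide_simps)
  from this[of "real (sylv_prod n)"]
  have "1 / real (sylv_prod n) = 1 / (1 + real (sylv_prod n)) + 1 / real (sylv_prod (Suc n))"
    using sylv_prod_pos[of n] by (simp only: sylv_prod.simps of_nat_mult of_nat_add of_nat_1 of_nat_0_less_iff)
  then show ?case using Suc by simp
qed simp

lemma prod_inverse_sylvester:
  "(\<Prod>i<n. 1 / (1 + real (sylv_prod i))) = 1 / real (sylv_prod n)"
  by (induction n) (simp_all add: distrib_left)

lemma sum_tail_diff:
  fixes f :: "nat \<Rightarrow> real"
  assumes "l \<le> Suc n"
  shows "(\<Sum>i=l..n. f i) = (\<Sum>i<Suc n. f i) - (\<Sum>i<l. f i)"
  using sum_diff_nat_ivl[of 0 l "Suc n" f] assms
  by (simp only: atLeastLessThanSuc_atLeastAtMost) (simp only: atLeast0LessThan atLeast0AtMost lessThan_Suc_atMost)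

text \<open>Soundararajan's argument. At the first \<open>j\<close> where the bound fails, the total
  of \<open>y\<close> exceeds that of the reciprocal Sylvester numbers \<open>c\<close> while no
  shorter initial sum does, so every tail of \<open>c\<close> is at most that of \<open>y\<close>.
  AM-GM makes the product of \<open>y\<close> at least \<open>1 / sylv_prod j\<close>, more than the
  remainder \<open>1 - (\<Sum>i<j. y i)\<close>.\<close>

lemma sum_le_of_prod_le_remainder:
  fixes y :: "nat \<Rightarrow> real"
  assumes nonneg: "\<And>i. i < n \<Longrightarrow> 0 \<le> y i"
    and dec: "\<And>i. Suc i < n \<Longrightarrow> y (Suc i) \<le> y i"
    and prod: "\<And>j. 1 \<le> j \<Longrightarrow> j \<le> n \<Longrightarrow> (\<Prod>i<j. y i) \<le> 1 - (\<Sum>i<j. y i)"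
    and "j \<le> n"
  shows "(\<Sum>i<j. y i) \<le> 1 - 1 / real (sylv_prod j)"
  using \<open>j \<le> n\<close>
proof (induction j rule: less_induct)
  case (less j)
  show ?case
  proof (cases j)
    case 0
    then show ?thesis by simp
  next
    case (Suc m)
    define c where "c i = 1 / (1 + real (sylv_prod i))" for i
    have cs: "(\<Sum>i<l. c i) = 1 - 1 / real (sylv_prod l)" for l
      unfolding c_def by (rule sum_inverse_sylvester)
    have cpos: "0 < c i" for i unfolding c_def by (simp add: add_pos_nonneg)
    have IH: "(\<Sum>i<l. y i) \<le> (\<Sum>i<l. c i)" if "l \<le> m" for l
      using less.IH[of l] less.prems that Suc by (simp add: cs)
    show ?thesis
    proof (rule ccontr)
      assume neg: "\<not> ?thesis"
      then have gt: "(\<Sum>i<Suc m. y i) > (\<Sum>i<Suc m. c i)" using cs[of "Suc m"] Suc by simp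
      have ym: "y m > 0"
        using gt IH[of m] cpos[of m] by simp
      have mono: "y k \<le> y i" if "i \<le> k" "k \<le> m" for i k
        using that
      proof (induction rule: dec_induct)
        case base then show ?case by simp
      next
        case (step k) then show ?case using dec[of k] less.prems Suc by simp
      qed
      have "(\<Prod>i\<le>m. c i) \<le> (\<Prod>i\<le>m. y i)"
      proof (rule prod_le_prod_of_tail_sums_le)
        show "0 < y i" if "i \<le> m" for i using mono[of i m] that ym by simp
        show "y (Suc i) \<le> y i" if "i < m" for i using mono[of i "Suc i"] that by simp
        show "0 < c i" for i by (rule cpos)
        show "(\<Sum>i=l..m. c i) \<le> (\<Sum>i=l..m. y i)" if "l \<le> m" for l
          using sum_tail_diff[of l m c] sum_tail_diff[of l m y] IH[OF that] gt that by linarith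
      qed
      then have "1 / real (sylv_prod j) \<le> (\<Prod>i<j. y i)"
        using prod_inverse_sylvester[of "Suc m"] Suc
        by (simp only: c_def lessThan_Suc_atMost[symmetric])
      then show False using prod[of j] less.prems neg Suc by simp
    qed
  qed
qed

text \<open>Used to merge a coordinate \<open>a\<close> into the lumped quantity \<open>S\<close>.
  After division by \<open>S ^ (e + 1)\<close> everything depends on \<open>x = a / S\<close>, which
  lies between \<open>1 / M\<close> and 1. For small \<open>x\<close> the bound
  \<open>1 \<le> M * x\<close> suffices, for large \<open>x\<close> the bound
  \<open>4 \<le> M\<close>.\<close>

lemma power_add_le:
  fixes a S M :: real
  assumes "4 \<le> M" "2 \<le> e" "0 < a" "a \<le> S" "S \<le> M * a"
  shows "(a + S) ^ (e + 1) \<le> 2 ^ (e - 1) * M * a * S ^ e"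
proof -
  define x where "x = a / S"
  have S: "S > 0" using assms by simp
  have x: "1 / M \<le> x" "x \<le> 1" "0 < x" using assms S by (auto simp: x_def field_simps)
  obtain f where f: "e = f + 2" using \<open>2 \<le> e\<close> by (metis add.commute le_iff_add)
  have small: "(5/4) ^ (f + 3) \<le> (2::real) ^ (f + 1)"
  proof (induction f)
    case 0 show ?case by (simp add: power3_eq_cube)
  next
    case (Suc f)
    then have "(5/4) ^ (f + 3) * (5/4) \<le> (2::real) ^ (f + 1) * 2" by (intro mult_mono) auto
    moreover have "Suc f + 3 = Suc (f + 3)" "Suc f + 1 = Suc (f + 1)" by simp_all
    ultimately show ?case by (simp only: power_Suc2)
  qed
  have "(1 + x) ^ (f + 3) \<le> 2 ^ (f + 1) * M * x"
  proof (cases "x \<le> 1/4")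
    case True
    then have "(1 + x) ^ (f + 3) \<le> (5/4) ^ (f + 3)" using x by (intro power_mono) auto
    also have "\<dots> \<le> 2 ^ (f + 1) * 1" using small by simp
    also have "\<dots> \<le> 2 ^ (f + 1) * (M * x)" using x assms by (intro mult_left_mono) (auto simp: field_simps)
    finally show ?thesis by (simp add: mult_ac)
  next
    case False
    have "(1 + x) ^ (f + 3) = (1 + x) ^ f * (1 + x) ^ 3" by (simp add: power_add)
    also have "\<dots> \<le> 2 ^ f * (8 * x)"
    proof (rule mult_mono)
      show "(1 + x) ^ f \<le> 2 ^ f" using x by (intro power_mono) auto
      \<comment> \<open>This product equals \<open>8 * x - (1 + x) ^ 3\<close>. Its quadratic factor
        has the positive root \<open>sqrt 5 - 2\<close>, just below the threshold 1/4.\<close>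
      have "0 \<le> (1 - x) * (x * x + 4 * x - 1)"
      proof (rule mult_nonneg_nonneg)
        have "(1/4) * (1/4) \<le> x * x" using False by (intro mult_mono) auto
        then show "0 \<le> x * x + 4 * x - 1" using False by simp
      qed (use x in simp)
      then show "(1 + x) ^ 3 \<le> 8 * x" by (simp add: power3_eq_cube algebra_simps)
    qed (use x in auto)
    also have "\<dots> = 2 ^ (f + 1) * (4 * x)" by simp
    also have "\<dots> \<le> 2 ^ (f + 1) * (M * x)" using assms x by (intro mult_left_mono mult_right_mono) auto
    finally show ?thesis by (simp add: mult_ac)
  qed
  then have "(1 + x) ^ (f + 3) * S ^ (f + 3) \<le> 2 ^ (f + 1) * M * x * S ^ (f + 3)"
    using S by (intro mult_right_mono) auto
  moreover have "(1 + x) ^ (f + 3) * S ^ (f + 3) = (a + S) ^ (f + 3)"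
    using S by (simp add: x_def power_mult_distrib[symmetric] field_simps)
  moreover have "2 ^ (f + 1) * M * x * S ^ (f + 3) = 2 ^ (f + 1) * M * a * S ^ (f + 2)"
    using S by (simp add: x_def power_add power3_eq_cube power2_eq_square)
  moreover have "e + 1 = f + 3" "e - 1 = f + 1" using f by simp_all
  ultimately show ?thesis by (simp only: f)
qed

lemma power_two_mult_sylv_prod_le: "2 ^ e * sylv_prod m \<le> sylv_prod (m + e)"
proof (induction e)
  case (Suc e)
  have "2 ^ Suc e * sylv_prod m \<le> 2 * sylv_prod (m + e)" using Suc by simp
  also have "\<dots> \<le> (1 + sylv_prod (m + e)) * sylv_prod (m + e)"
    using sylv_prod_pos[of "m + e"] by (intro mult_le_mono1) linarith
  finally show ?case by (simp add: mult.commute)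
qed simp

text \<open>The inequality fails at \<open>n = 2\<close>, where it reads \<open>15 \<le> 6\<close>;
  hence the finite check for \<open>m + e < 3\<close> in \<open>sylv_prod_growth\<close>.\<close>

lemma sylv_prod_ge_linear: "3 \<le> n \<Longrightarrow> 3 * (n + 3) \<le> sylv_prod n"
proof (induction n rule: nat_induct_at_least)
  case base
  show ?case by (simp add: eval_nat_numeral)
next
  case (Suc n)
  have "3 * (Suc n + 3) \<le> 2 * sylv_prod n" using Suc by simp
  also have "\<dots> \<le> sylv_prod (Suc n)" using power_two_mult_sylv_prod_le[of 1 n] by simp
  finally show ?case .
qed

text \<open>
  The factor in front of the power of \<open>sylv_prod m\<close> is the loss incurred when the last \<open>e + 1\<close>
  coordinates are lumped together in \<open>prod_ge_of_prod_le_remainder\<close>. The estimate is nearly tight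
  for \<open>m + e \<le> 3\<close>, whence the case distinction.
\<close>

lemma sylv_prod_growth:
  "(real (m + e) + 2) ^ e * (\<Prod>f<e. 2 ^ f) * real (sylv_prod m) ^ (e + 2) \<le> real (sylv_prod (m + e)) ^ 2"
proof (induction e)
  case 0
  show ?case by (simp add: power2_eq_square)
next
  case (Suc e)
  show ?case
  proof (cases "m + e < 3")
    case True
    then consider "m = 0" "e = 0" | "m = 0" "e = 1" | "m = 0" "e = 2"
      | "m = 1" "e = 0" | "m = 1" "e = 1" | "m = 2" "e = 0"
      by linarith
    then show ?thesis
      by cases (simp_all add: eval_nat_numeral lessThan_Suc)
  next
    case False
    define N where "N = real (m + e) + 2"
    define Pm where "Pm = real (sylv_prod m)"
    define Pn where "Pn = real (sylv_prod (m + e))"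
    have N: "N > 0" "real e \<le> N" by (auto simp: N_def)
    have Pm: "Pm > 0" using sylv_prod_pos by (simp add: Pm_def)
    \<comment> \<open>Raising \<open>m + e\<close> by one turns the base \<open>N\<close> into
      \<open>N + 1\<close>. Since \<open>e \<le> N\<close>, this costs at most the factor
      \<open>exp 1 \<le> 3\<close>.\<close>
    have "(1 + 1 / N) ^ e \<le> exp (1 / N) ^ e"
      using N by (intro power_mono exp_ge_add_one_self) auto
    also have "\<dots> = exp (real e / N)" by (simp add: exp_of_nat_mult[symmetric])
    also have "\<dots> \<le> exp 1" using N by simp
    also have "\<dots> \<le> 3" by (rule exp_le)
    finally have "(1 + 1 / N) ^ e * N ^ e \<le> 3 * N ^ e" using N by (intro mult_right_mono) auto
    moreover have "(1 + 1 / N) * N = N + 1" using N by (simp add: distrib_right)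
    ultimately have *: "(N + 1) ^ e \<le> 3 * N ^ e" by (simp only: power_mult_distrib[symmetric])
    have "real (2 ^ e * sylv_prod m) \<le> real (sylv_prod (m + e))"
      using power_two_mult_sylv_prod_le[of e m] by (simp only: of_nat_le_iff)
    then have a: "2 ^ e * Pm \<le> Pn" by (simp add: Pm_def Pn_def)
    have "real (3 * (m + e + 3)) \<le> Pn"
      using sylv_prod_ge_linear[of "m + e"] False unfolding Pn_def of_nat_le_iff by simp
    then have b: "3 * (N + 1) \<le> Pn" by (simp add: N_def)
    have Pn: "Pn > 0" using sylv_prod_pos by (simp add: Pn_def)
    \<comment> \<open>The left side collects all new factors of the induction step. The right side
      is what squaring \<open>sylv_prod (Suc n) = Pn * (1 + Pn)\<close>, with
      \<open>n = m + e\<close>, gains over \<open>Pn ^ 2\<close>.\<close>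
    have c: "(3 * (N + 1)) * (2 ^ e * Pm) \<le> (1 + Pn) ^ 2"
    proof -
      have "(3 * (N + 1)) * (2 ^ e * Pm) \<le> Pn * Pn"
        using a b Pm Pn N by (intro mult_mono) auto
      also have "\<dots> \<le> (1 + Pn) ^ 2" using Pn by (simp add: power2_eq_square algebra_simps)
      finally show ?thesis .
    qed
    have "(N + 1) ^ Suc e * (\<Prod>f<Suc e. 2 ^ f) * Pm ^ (Suc e + 2)
        = (N + 1) ^ e * ((N + 1) * (2 ^ e * Pm) * ((\<Prod>f<e. 2 ^ f) * Pm ^ (e + 2)))"
      by (simp add: mult_ac)
    also have "\<dots> \<le> 3 * N ^ e * ((N + 1) * (2 ^ e * Pm) * ((\<Prod>f<e. 2 ^ f) * Pm ^ (e + 2)))"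
      using * N Pm by (intro mult_right_mono mult_nonneg_nonneg prod_nonneg) auto
    also have "\<dots> = (3 * (N + 1)) * (2 ^ e * Pm) * (N ^ e * (\<Prod>f<e. 2 ^ f) * Pm ^ (e + 2))"
      by (simp add: mult_ac)
    also have "\<dots> \<le> (1 + Pn) ^ 2 * Pn ^ 2"
      using c Suc.IH Pm N by (intro mult_mono) (auto simp: N_def Pm_def Pn_def intro!: prod_nonneg mult_nonneg_nonneg)
    also have "\<dots> = real (sylv_prod (m + Suc e)) ^ 2"
      by (simp add: Pn_def power_mult_distrib[symmetric] algebra_simps)
    finally show ?thesis by (simp add: N_def Pm_def add_ac)
  qed
qed

text \<open>The right side minus the left is \<open>(a - b) * ((M - 1) ^ 2 * b - a)\<close>, and
  \<open>3 \<le> M\<close> gives \<open>M \<le> (M - 1) ^ 2\<close>. Equality holds at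
  \<open>a = b\<close>, so the first merging step below leaves no room for a cruder
  estimate.\<close>

lemma square_le_of_ratio_bounds:
  fixes a b M :: real
  assumes "3 \<le> M" "0 < b" "b \<le> a" "a \<le> M * b"
  shows "(a + (M - 1) * b) ^ 2 \<le> M * (M * (a * b))"
proof -
  have "0 \<le> M * (M - 3)" using assms by simp
  then have "M \<le> (M - 1) ^ 2" by (simp add: power2_eq_square algebra_simps)
  then have "a \<le> (M - 1) ^ 2 * b" using assms by (meson mult_right_mono less_imp_le order_trans)
  then have "0 \<le> (a - b) * ((M - 1) ^ 2 * b - a)" using assms by simp
  then show ?thesis by (simp add: power2_eq_square algebra_simps)
qed

text \<open>Soundararajan's inequality for \<open>a i - \<epsilon>\<close> gives
  \<open>1 / P j \<le> S j\<close>. AM-GM handles the first \<open>m\<close> coordinates together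
  with the lumped tail \<open>S m\<close>; the tail is then compared with the product of the
  remaining coordinates, and \<open>sylv_prod_growth\<close> absorbs the loss.\<close>

lemma prod_ge_of_prod_le_remainder:
  fixes a :: "nat \<Rightarrow> real"
  assumes dec: "\<And>i. i < n \<Longrightarrow> a (Suc i) \<le> a i" and eps: "0 < \<epsilon>" "\<epsilon> \<le> a n"
    and sum: "(\<Sum>i\<le>n. a i) + \<epsilon> = 1"
    and prod: "\<And>j. 1 \<le> j \<Longrightarrow> j \<le> n \<Longrightarrow> (\<Prod>i<j. a i - \<epsilon>) \<le> 1 - (\<Sum>i<j. a i)"
  shows "1 \<le> real (n + 2) * real (sylv_prod n) ^ 2 * (\<Prod>i\<le>n. a i)"
proof -
  define b where "b = a n"
  define M where "M = real n + 2"
  define P where "P j = real (sylv_prod j)" for j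
  \<comment> \<open>This is the tail sum from \<open>j\<close> to \<open>n\<close> plus
    \<open>j + 1\<close> further copies of \<open>b = a n\<close>: they replace the coordinate
    \<epsilon> and the \<open>j\<close> copies of \<epsilon> subtracted in the initial sum.\<close>
  define S where "S j = (\<Sum>i=j..<n. a i) + (real j + 2) * b" for j
  have P: "P j > 0" for j using sylv_prod_pos by (simp add: P_def)
  have mono: "a k \<le> a i" if "i \<le> k" "k \<le> n" for i k
    using that
  proof (induction rule: dec_induct)
    case (step k) then show ?case using dec[of k] by simp
  qed simp
  have b: "0 < b" "\<epsilon> \<le> b" using eps by (auto simp: b_def)
  have ab: "b \<le> a i" if "i \<le> n" for i using mono[of i n] that by (simp add: b_def)
  have apos: "0 < a i" if "i \<le> n" for i using ab[OF that] b by simp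
  have S_ge: "1 / P j \<le> S j" if "j \<le> n" for j
  proof -
    have "(\<Sum>i<j. a i - \<epsilon>) \<le> 1 - 1 / real (sylv_prod j)"
    proof (rule sum_le_of_prod_le_remainder[OF _ _ _ that])
      show "0 \<le> a i - \<epsilon>" if "i < n" for i using ab[of i] b that by simp
      show "a (Suc i) - \<epsilon> \<le> a i - \<epsilon>" if "Suc i < n" for i using dec[of i] that by simp
      fix j assume j: "1 \<le> j" "j \<le> n"
      have "(\<Sum>i<j. a i - \<epsilon>) \<le> (\<Sum>i<j. a i)" using eps by (intro sum_mono) simp
      then show "(\<Prod>i<j. a i - \<epsilon>) \<le> 1 - (\<Sum>i<j. a i - \<epsilon>)" using prod[OF j] by linarith
    qed
    then have "1 / P j \<le> 1 - (\<Sum>i<j. a i) + real j * \<epsilon>"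
      by (simp add: P_def sum_subtractf)
    also have "\<dots> = (\<Sum>i=j..n. a i) + (real j + 1) * \<epsilon>"
      using sum sum_tail_diff[of j n a] that by (simp add: lessThan_Suc_atMost[symmetric] algebra_simps)
    also have "\<dots> \<le> (\<Sum>i=j..n. a i) + (real j + 1) * b"
      using b by simp
    also have "\<dots> = S j"
      using that by (simp add: S_def b_def sum.last_plus algebra_simps)
    finally show ?thesis .
  qed
  have S_pos: "0 < S j" if "j \<le> n" for j using S_ge[OF that] P[of j] by (smt (verit) divide_pos_pos)
  have S_le: "S j \<le> M * a j" if "j \<le> n" for j
  proof -
    have "(\<Sum>i=j..<n. a i) \<le> (\<Sum>i=j..<n. a j)" using mono by (intro sum_mono) auto
    moreover have "(real j + 2) * b \<le> (real j + 2) * a j" using ab[OF that] by (intro mult_left_mono) auto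
    ultimately have "S j \<le> real (n - j) * a j + (real j + 2) * a j" by (simp only: S_def sum_constant card_atLeastLessThan)
    then show ?thesis using that by (simp add: M_def of_nat_diff algebra_simps)
  qed
  have S_rec: "S j = a j + S (Suc j) - b" if "j < n" for j
    using that by (simp add: S_def sum.atLeast_Suc_lessThan algebra_simps)
  \<comment> \<open>The sequence \<open>a 0, \<dots>, a (m - 1), S m\<close> is decreasing, so AM-GM applies to it; the remaining
    \<open>a m, \<dots>, a n\<close> are comparable to one another because \<open>m\<close> is maximal.\<close>
  define ok where "ok m \<longleftrightarrow> m \<le> n \<and> (m = 0 \<or> S m \<le> a (m - 1))" for m
  define m where "m = (GREATEST m. ok m)"
  have "ok 0" by (simp add: ok_def)
  then have "ok m" unfolding m_def by (rule GreatestI_nat[where b = n]) (simp add: ok_def)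
  then have m: "m \<le> n" "m = 0 \<or> S m \<le> a (m - 1)" by (auto simp: ok_def)
  have not_ok: "a i < S (Suc i)" if "m \<le> i" "i < n" for i
  proof (rule ccontr)
    assume "\<not> ?thesis"
    then have "ok (Suc i)" using that by (simp add: ok_def)
    then have "Suc i \<le> m" unfolding m_def by (rule Greatest_le_nat[where b = n]) (simp add: ok_def)
    then show False using that by simp
  qed
  \<comment> \<open>Coordinates are merged backwards, starting from the equality
    \<open>S n = M * a n\<close>. The step from \<open>e\<close> to \<open>e + 1\<close> costs the
    factor \<open>2 ^ e * M\<close>.\<close>
  have group: "S (n - e) ^ (e + 1) \<le> M ^ e * (\<Prod>f<e. 2 ^ f) * (M * (\<Prod>i=n-e..n. a i))"
    if "e \<le> n - m" for e
    using that
  proof (induction e)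
    case 0
    then show ?case by (simp add: S_def M_def b_def)
  next
    case (Suc e)
    define i where "i = n - Suc e"
    have i: "m \<le> i" "i < n" "Suc i = n - e" "n - Suc e = i" using Suc.prems m by (auto simp: i_def)
    have ai: "0 < a i" "a i \<le> S (Suc i)" using apos[of i] not_ok[of i] i by auto
    have prod_i: "(\<Prod>l=i..n. a l) = a i * (\<Prod>l=Suc i..n. a l)"
      using i by (simp add: prod.atLeast_Suc_atMost)
    show ?case
    proof (cases e)
      case 0
      then have "Suc i = n" using i by simp
      then have "S (Suc i) = M * b" "S i = a i + (M - 1) * b"
        using S_rec[OF i(2)] by (auto simp: S_def M_def algebra_simps)
      moreover have "(a i + (M - 1) * b) ^ 2 \<le> M * (M * (a i * b))"
        using square_le_of_ratio_bounds[of M b "a i"] b ab[of i] ai i calculation \<open>Suc i = n\<close> by (simp add: M_def)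
      ultimately show ?thesis
        using 0 prod_i \<open>Suc i = n\<close> i by (simp add: b_def power2_eq_square)
    next
      case e: (Suc e')
      \<comment> \<open>From the second merging step on, \<open>n\<close> is at least 2, and the
        term \<open>- b\<close> in \<open>S_rec\<close> may be dropped.\<close>
      have M: "4 \<le> M" using Suc.prems e m by (simp add: M_def)
      have "S (Suc i) \<le> M * a (Suc i)" using S_le[of "Suc i"] i by simp
      also have "\<dots> \<le> M * a i" using dec[of i] i M by (intro mult_left_mono) auto
      finally have SM: "S (Suc i) \<le> M * a i" .
      have "S i ^ (Suc e + 1) \<le> (a i + S (Suc i)) ^ (Suc e + 1)"
        using S_pos[of i] S_rec[of i] b i by (intro power_mono) auto
      also have "\<dots> \<le> 2 ^ (Suc e - 1) * M * a i * S (Suc i) ^ Suc e"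
        by (rule power_add_le) (use M ai SM e in auto)
      also have "\<dots> = 2 ^ e * M * a i * S (n - e) ^ (e + 1)" using i by simp
      also have "\<dots> \<le> 2 ^ e * M * a i * (M ^ e * (\<Prod>f<e. 2 ^ f) * (M * (\<Prod>i=n-e..n. a i)))"
        using Suc M ai by (intro mult_left_mono) auto
      also have "\<dots> = M ^ Suc e * (\<Prod>f<Suc e. 2 ^ f) * (M * (\<Prod>l=i..n. a l))"
        unfolding prod_i i(3) by (simp add: mult_ac)
      finally show ?thesis unfolding i(4) .
    qed
  qed
  define e where "e = n - m"
  define R where "R = (\<Prod>i<m. a i)"
  have e: "m + e = n" "n - e = m" using m by (auto simp: e_def)
  have Rpos: "R > 0" unfolding R_def using apos m by (intro prod_pos) auto
  have amgm: "1 / P m ^ 2 \<le> R * S m"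
  proof -
    define u where "u i = (if i < m then a i else S m)" for i
    \<comment> \<open>The tails of \<open>c\<close> telescope to exactly \<open>1 / P j\<close>, the
      lower bound for \<open>S j\<close>, and its product is \<open>1 / P m ^ 2\<close>.\<close>
    define c where "c i = (if i < m then 1 / (1 + P i) else 1 / P m)" for i
    have split: "(\<Sum>i=j..m. g i) = (\<Sum>i=j..<m. g i) + g m" if "j \<le> m" for j and g :: "nat \<Rightarrow> real"
      using that by (simp add: sum.last_plus)
    have "(\<Prod>i\<le>m. c i) \<le> (\<Prod>i\<le>m. u i)"
    proof (rule prod_le_prod_of_tail_sums_le)
      show "0 < u i" if "i \<le> m" for i using S_pos[of m] apos[of i] m that by (simp add: u_def)
      show "u (Suc i) \<le> u i" if "i < m" for i
      proof (cases "Suc i < m")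
        case True then show ?thesis using dec[of i] m by (simp add: u_def)
      next
        case False
        then have "m = Suc i" using that by simp
        then show ?thesis using m by (simp add: u_def)
      qed
      show "0 < c i" for i using P by (simp add: c_def add_pos_pos)
      show "(\<Sum>i=j..m. c i) \<le> (\<Sum>i=j..m. u i)" if j: "j \<le> m" for j
      proof -
        have "(\<Sum>i=j..m. c i) = (\<Sum>i=j..<m. 1 / (1 + P i)) + 1 / P m"
          unfolding split[OF j] by (simp add: c_def)
        also have "(\<Sum>i=j..<m. 1 / (1 + P i)) = (\<Sum>i<m. 1 / (1 + P i)) - (\<Sum>i<j. 1 / (1 + P i))"
          using sum_diff_nat_ivl[of 0 j m "\<lambda>i. 1 / (1 + P i)"] j by (simp add: atLeast0LessThan)
        also have "\<dots> = 1 / P j - 1 / P m"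
          unfolding P_def sum_inverse_sylvester by simp
        finally have "(\<Sum>i=j..m. c i) = 1 / P j" by simp
        also have "\<dots> \<le> S j" using S_ge[of j] j m by simp
        also have "\<dots> = (\<Sum>i=j..<m. a i) + (\<Sum>i=m..<n. a i) + (real j + 2) * b"
          using sum.atLeastLessThan_concat[of j m n a] j m by (simp add: S_def)
        also have "\<dots> \<le> (\<Sum>i=j..<m. a i) + S m"
          using b j by (simp add: S_def)
        also have "\<dots> = (\<Sum>i=j..m. u i)"
          unfolding split[OF j] by (simp add: u_def)
        finally show ?thesis .
      qed
    qed
    moreover have "(\<Prod>i\<le>m. c i) = (\<Prod>i<m. 1 / (1 + real (sylv_prod i))) * (1 / P m)"
      unfolding lessThan_Suc_atMost[symmetric] prod.lessThan_Suc by (simp add: c_def P_def)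
    moreover have "(\<Prod>i\<le>m. u i) = R * S m"
      unfolding lessThan_Suc_atMost[symmetric] prod.lessThan_Suc by (simp add: u_def R_def)
    ultimately show ?thesis
      unfolding prod_inverse_sylvester by (simp add: P_def power2_eq_square)
  qed
  define K where "K = M ^ e * (\<Prod>f<e. 2 ^ f)"
  have K: "K > 0" unfolding K_def M_def by (intro mult_pos_pos zero_less_power prod_pos) auto
  define Q where "Q = (\<Prod>i=m..n. a i)"
  have PQ: "(\<Prod>i\<le>n. a i) = R * Q"
  proof -
    have "(\<Prod>i=0..<m. a i) * (\<Prod>i=m..<Suc n. a i) = (\<Prod>i=0..<Suc n. a i)"
      by (rule prod.atLeastLessThan_concat) (use m in auto)
    then show ?thesis
      by (simp only: R_def Q_def atLeastLessThanSuc_atLeastAtMost atLeast0LessThan atLeast0AtMost)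
  qed
  have "K * P m ^ (e + 2) \<le> P n ^ 2"
    using sylv_prod_growth[of m e] e by (simp add: K_def M_def P_def)
  \<comment> \<open>Two of the \<open>e + 2\<close> factors \<open>1 / P m\<close> are paid for by
    \<open>amgm\<close>, each of the others by one factor \<open>S m\<close>. This produces the
    power \<open>S m ^ (e + 1)\<close> that \<open>group\<close> converts into coordinates.\<close>
  then have "1 \<le> P n ^ 2 / (K * P m ^ (e + 2))" using K P by (simp add: le_divide_eq_1)
  also have "\<dots> = P n ^ 2 * ((1 / P m ^ 2) * (1 / P m) ^ e) / K"
    by (simp add: power_add power_one_over power2_eq_square)
  also have "\<dots> \<le> P n ^ 2 * ((R * S m) * S m ^ e) / K"
    using amgm S_ge[OF m(1)] P K Rpos S_pos[OF m(1)]
    by (intro divide_right_mono mult_left_mono mult_mono power_mono) (auto simp: less_imp_le)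
  also have "\<dots> = P n ^ 2 * R * (S m ^ (e + 1) / K)" by simp
  also have "\<dots> \<le> P n ^ 2 * R * (M * Q)"
    using group[of e] K Rpos e P by (intro mult_left_mono) (auto simp: K_def Q_def e_def divide_le_eq mult_ac)
  finally show ?thesis by (simp add: PQ M_def P_def mult_ac add.commute)
qed

section \<open>Linear images of measurable sets and Blichfeldt's principle\<close>

text \<open>
  The library proves the transformation formula only for index types of class
  \<open>wellorder\<close>; here the index type is merely finite.
\<close>

lemma measure_lebesgue_shear_cbox:
  fixes a b :: "real^'n"
  assumes "m \<noteq> n"
  shows "measure lebesgue ((\<lambda>x. \<chi> i. if i = m then x$m + x$n else x$i) ` cbox a b) = measure lebesgue (cbox a b)"
    (is "measure _ (?h ` _) = _")
proof (cases "cbox a b = {}")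
  case False
  \<comment> \<open>This translation moves the \<open>n\<close>-th lower bound of the box to 0, as
    \<open>measure_shear_interval\<close> asks for a nonnegative one.\<close>
  define w :: "real^'n" where "w = axis n (- a $ n)"
  have h: "?h (w + x) = ?h w + ?h x" for x
    by (simp add: vec_eq_iff)
  have "measure lebesgue (?h ` cbox a b) = measure lebesgue ((+) (?h w) ` ?h ` cbox a b)"
    by (rule measure_translation[symmetric])
  also have "(+) (?h w) ` ?h ` cbox a b = ?h ` (+) w ` cbox a b"
    unfolding image_image h ..
  also have "(+) w ` cbox a b = cbox (w + a) (w + b)"
    by (rule cbox_translation[symmetric])
  also have "measure lebesgue (?h ` cbox (w + a) (w + b)) = measure lebesgue (cbox (w + a) (w + b))"
  proof (rule measure_shear_interval[OF assms])
    show "cbox (w + a) (w + b) \<noteq> {}"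
      using False unfolding cbox_translation by simp
  qed (simp add: w_def axis_def)
  also have "\<dots> = measure lebesgue (cbox a b)"
    by (simp only: cbox_translation measure_translation)
  finally show ?thesis .
qed simp

text \<open>The formula is multiplicative under composition, so it suffices to treat maps with a
  vanishing coordinate, coordinate stretches, transpositions and shears.\<close>

lemma measure_lebesgue_linear_image:
  fixes f :: "real^'n \<Rightarrow> real^'n"
  assumes "linear f" "S \<in> lmeasurable"
  shows "f ` S \<in> lmeasurable" "measure lebesgue (f ` S) = \<bar>det (matrix f)\<bar> * measure lebesgue S"
proof -
  define P where "P f \<longleftrightarrow> (\<forall>S\<in>lmeasurable. f ` S \<in> lmeasurable \<and>
      measure lebesgue (f ` S) = \<bar>det (matrix f)\<bar> * measure lebesgue S)" for f :: "real^'n \<Rightarrow> real^'n"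
  \<comment> \<open>For determinant of absolute value 1, preserving the volume of boxes is enough;
    this covers transpositions and shears.\<close>
  have boxes: "P f" if "linear f" "\<bar>det (matrix f)\<bar> = 1"
    "\<And>a b. measure lebesgue (f ` cbox a b) = measure lebesgue (cbox a b)" for f
    unfolding P_def that(2)
  proof
    fix S :: "(real^'n) set" assume S: "S \<in> lmeasurable"
    have "f ` S \<in> lmeasurable \<and> 1 * measure lebesgue S = measure lebesgue (f ` S)"
      by (rule measure_linear_sufficient[OF that(1) S]) (simp only: that(3) mult_1)
    then show "f ` S \<in> lmeasurable \<and> measure lebesgue (f ` S) = 1 * measure lebesgue S" by simp
  qed
  have "P f"
    using \<open>linear f\<close>
  proof (rule induct_linear_elementary)
    fix f g :: "real^'n \<Rightarrow> real^'n"
    assume "linear f" "linear g" "P f" "P g"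
    then show "P (f \<circ> g)"
      by (simp only: P_def image_comp[symmetric] matrix_compose det_mul abs_mult) simp
  next
    fix f :: "real^'n \<Rightarrow> real^'n" and i
    assume f: "linear f" "\<And>x. f x $ i = 0"
    have "negligible (f ` S)" for S
      by (rule negligible_subset[OF negligible_standard_hyperplane_cart[of i]]) (use f in auto)
    moreover have "det (matrix f) = 0"
      by (rule det_zero_row(2)[of i]) (simp add: row_def matrix_def f(2) vec_eq_iff)
    ultimately show "P f" by (simp add: P_def negligible_iff_measure)
  next
    fix c :: "'n \<Rightarrow> real"
    show "P (\<lambda>x. \<chi> i. c i * x $ i)"
      by (simp add: P_def measurable_stretch measure_stretch matrix_def axis_def det_diagonal)
  next
    fix m n :: 'n
    assume "m \<noteq> n"
    let ?t = "Transposition.transpose m n"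
    let ?h = "\<lambda>x::real^'n. \<chi> i. x $ ?t i"
    show "P ?h"
    proof (rule boxes)
      show "linear ?h" by (rule linearI) (simp_all add: vec_eq_iff)
      have "matrix ?h = (\<chi> i. (mat 1 :: real^'n^'n) $ ?t i)"
        by (simp add: matrix_def mat_def axis_def vec_eq_iff)
      then show "\<bar>det (matrix ?h)\<bar> = 1"
        by (simp add: det_permute_rows permutes_swap_id sign_def)
      fix a b :: "real^'n"
      have "?h ` cbox a b = cbox (?h a) (?h b)"
      proof (intro equalityI subsetI)
        fix x assume x: "x \<in> cbox (?h a) (?h b)"
        have "x = ?h (?h x)" by (simp add: vec_eq_iff)
        moreover have "?h x \<in> cbox a b"
          using x by (auto simp: mem_box_cart) (metis transpose_involutory)+
        ultimately show "x \<in> ?h ` cbox a b" by (rule image_eqI)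
      qed (auto simp: mem_box_cart)
      moreover have "(cbox (?h a) (?h b) = {}) = (cbox a b = {})"
        using calculation by (metis image_is_empty)
      moreover have "(\<Prod>i\<in>UNIV. b $ ?t i - a $ ?t i) = (\<Prod>i\<in>UNIV. b $ i - a $ i)"
        using prod.permute[OF permutes_swap_id[of m UNIV n], of "\<lambda>i. b $ i - a $ i"] by (simp add: o_def)
      ultimately show "measure lebesgue (?h ` cbox a b) = measure lebesgue (cbox a b)"
        by (simp add: content_cbox_if_cart)
    qed
  next
    fix m n :: 'n
    assume mn: "m \<noteq> n"
    let ?h = "\<lambda>x::real^'n. \<chi> i. if i = m then x$m + x$n else x$i"
    show "P ?h"
    proof (rule boxes)
      show "linear ?h" by (rule linearI) (simp_all add: vec_eq_iff algebra_simps)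
      have "matrix ?h = (\<chi> k. if k = m then row m (mat 1 :: real^'n^'n) + 1 *s row n (mat 1) else row k (mat 1))"
        by (simp add: matrix_def mat_def axis_def row_def vec_eq_iff)
      then show "\<bar>det (matrix ?h)\<bar> = 1"
        by (simp only: det_row_operation[OF mn]) simp
    qed (rule measure_lebesgue_shear_cbox[OF mn])
  qed
  then show "f ` S \<in> lmeasurable" "measure lebesgue (f ` S) = \<bar>det (matrix f)\<bar> * measure lebesgue S"
    using assms by (auto simp: P_def)
qed

section \<open>Blichfeldt's principle and its consequences\<close>

lemma lattice_point_diff: "lattice_point x \<Longrightarrow> lattice_point y \<Longrightarrow> lattice_point (x - y)"
  by (simp add: lattice_point_def)

text \<open>Cut \<open>A\<close> into its pieces in the half-open unit cells and translate each
  piece into the unit cube. The pieces have total volume above \<open>k\<close>, so some point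
  \<open>p\<close> lies in at least \<open>k + 1\<close> of them; moving \<open>p\<close> back by
  the corresponding cell corners gives the required points.\<close>

theorem blichfeldt:
  fixes A :: "(real^'n) set"
  assumes A: "A \<in> lmeasurable" "bounded A" and k: "real k < measure lebesgue A"
  obtains P where "finite P" "card P = k + 1" "P \<subseteq> A"
    "\<And>x y. x \<in> P \<Longrightarrow> y \<in> P \<Longrightarrow> lattice_point (x - y)"
proof -
  define fl :: "real^'n \<Rightarrow> real^'n" where "fl x = (\<chi> i. of_int \<lfloor>x $ i\<rfloor>)" for x
  define B where "B z = (+) (- z) ` {x\<in>A. fl x = z}" for z
  define C where "C = cbox 0 (1::real^'n)"
  have lat: "lattice_point (fl x)" for x by (simp add: lattice_point_def fl_def)
  obtain r where r: "\<And>x. x \<in> A \<Longrightarrow> norm x \<le> r" using A(2) bounded_iff by blast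
  define F :: "real set" where "F = of_int ` {\<lfloor>- r\<rfloor>..\<lfloor>r\<rfloor>}"
  have finite_fl: "finite (fl ` A)"
  proof (rule finite_subset)
    show "fl ` A \<subseteq> vec_lambda ` (UNIV \<rightarrow>\<^sub>E F)"
    proof
      fix z assume "z \<in> fl ` A"
      then obtain x where x: "x \<in> A" "z = fl x" by auto
      have "\<lfloor>x $ i\<rfloor> \<in> {\<lfloor>- r\<rfloor>..\<lfloor>r\<rfloor>}" for i
        using component_le_norm_cart[of x i] r[OF x(1)] by (auto intro!: floor_mono)
      then have "(\<lambda>i. of_int \<lfloor>x $ i\<rfloor>) \<in> UNIV \<rightarrow>\<^sub>E F" by (auto simp: F_def)
      then show "z \<in> vec_lambda ` (UNIV \<rightarrow>\<^sub>E F)" unfolding x(2) fl_def by (rule imageI)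
    qed
    show "finite (vec_lambda ` (UNIV \<rightarrow>\<^sub>E F) :: (real^'n) set)"
      by (intro finite_imageI finite_PiE) (auto simp: F_def)
  qed
  have cell: "{x\<in>A. fl x = z} \<in> lmeasurable" for z
  proof (cases "lattice_point z")
    case True
    have "fl x = z \<longleftrightarrow> (\<forall>i. z $ i \<le> x $ i \<and> x $ i < z $ i + 1)" for x
    proof -
      have "of_int \<lfloor>x $ i\<rfloor> = z $ i \<longleftrightarrow> z $ i \<le> x $ i \<and> x $ i < z $ i + 1" for i
      proof -
        obtain m :: int where "z $ i = of_int m"
          using True by (auto simp: lattice_point_def elim: Ints_cases)
        then show ?thesis by (simp add: floor_eq_iff)
      qed
      then show ?thesis by (simp add: fl_def vec_eq_iff)
    qed
    then have "{x\<in>A. fl x = z} = A \<inter> {x. \<forall>i. z $ i \<le> x $ i \<and> x $ i < z $ i + 1}" by auto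
    moreover have "{x::real^'n. \<forall>i. z $ i \<le> x $ i \<and> x $ i < z $ i + 1} \<in> sets lebesgue"
    proof -
      have "{x::real^'n. \<forall>i. z $ i \<le> x $ i \<and> x $ i < z $ i + 1} =
        (\<Inter>i\<in>UNIV. {x. z $ i \<le> x $ i} \<inter> {x. x $ i < z $ i + 1})" by auto
      also have "\<dots> \<in> sets borel"
        by (intro sets.finite_INT sets.Int)
          (auto intro!: borel_closed borel_open closed_halfspace_component_ge_cart open_halfspace_component_lt_cart)
      finally show ?thesis by simp
    qed
    ultimately show ?thesis using A(1) by (simp add: fmeasurable_Int_fmeasurable)
  next
    case False
    then have "{x\<in>A. fl x = z} = {}" using lat by blast
    then show ?thesis by (simp only: fmeasurable.empty_sets)
  qed
  have B: "B z \<in> lmeasurable" "measure lebesgue (B z) = measure lebesgue {x\<in>A. fl x = z}" for z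
    unfolding B_def by (rule measurable_translation[OF cell], rule measure_translation)
  have int: "integrable lebesgue (indicat_real (B z))" for z
    by (rule integrable_real_indicator) (use B(1)[of z] in \<open>auto simp: fmeasurable_def\<close>)
  have BC: "B z \<subseteq> C" for z
    by (auto simp: B_def C_def fl_def mem_box_cart) linarith
  have "measure lebesgue A = measure lebesgue (\<Union>z\<in>fl ` A. {x\<in>A. fl x = z})"
    by (rule arg_cong[where f = "measure lebesgue"]) auto
  also have "\<dots> = (\<Sum>z\<in>fl ` A. measure lebesgue {x\<in>A. fl x = z})"
    by (rule measure_UNION_AE[OF finite_fl]) (auto simp: cell pairwise_def)
  also have "\<dots> = (\<Sum>z\<in>fl ` A. integral\<^sup>L lebesgue (indicat_real (B z)))"
    using B by simp
  also have "\<dots> = integral\<^sup>L lebesgue (\<lambda>x. \<Sum>z\<in>fl ` A. indicat_real (B z) x)"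
    by (rule Bochner_Integration.integral_sum[symmetric]) (rule int)
  finally have mA: "measure lebesgue A = integral\<^sup>L lebesgue (\<lambda>x. \<Sum>z\<in>fl ` A. indicat_real (B z) x)" .
  have count: "(\<Sum>z\<in>fl ` A. indicat_real (B z) x) = real (card {z\<in>fl ` A. x \<in> B z})" for x
    using finite_fl by (simp add: indicator_def sum.If_cases Int_def)
  have "\<exists>x. k < card {z\<in>fl ` A. x \<in> B z}"
  proof (rule ccontr)
    assume "\<not> ?thesis"
    then have le: "card {z\<in>fl ` A. x \<in> B z} \<le> k" for x by (simp add: not_less)
    have "integral\<^sup>L lebesgue (\<lambda>x. \<Sum>z\<in>fl ` A. indicat_real (B z) x) \<le> integral\<^sup>L lebesgue (\<lambda>x. real k * indicat_real C x)"
    proof (rule integral_mono)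
      show "integrable lebesgue (\<lambda>x. \<Sum>z\<in>fl ` A. indicat_real (B z) x)"
        by (intro Bochner_Integration.integrable_sum int)
      show "integrable lebesgue (\<lambda>x. real k * indicat_real C x)"
        unfolding C_def
        by (intro integrable_mult_right integrable_real_indicator) (simp_all add: emeasure_lborel_cbox_eq)
      show "(\<Sum>z\<in>fl ` A. indicat_real (B z) x) \<le> real k * indicat_real C x" for x
      proof (cases "x \<in> C")
        case True then show ?thesis using le[of x] by (simp only: count) simp
      next
        case False
        then have "{z\<in>fl ` A. x \<in> B z} = {}" using BC by auto
        then show ?thesis by (simp only: count) simp
      qed
    qed
    also have "\<dots> = real k" by (simp add: C_def content_cbox_if_cart interval_eq_empty_cart)
    finally show False using k mA by simp
  qed
  then obtain p where "k < card {z\<in>fl ` A. p \<in> B z}" by blast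
  then have "k + 1 \<le> card {z\<in>fl ` A. p \<in> B z}" by simp
  then obtain Z where Z: "Z \<subseteq> {z\<in>fl ` A. p \<in> B z}" "card Z = k + 1" "finite Z"
    by (rule obtain_subset_with_card_n)
  show thesis
  proof
    show "finite ((+) p ` Z)" "card ((+) p ` Z) = k + 1"
      using Z by (auto simp: card_image)
    show "(+) p ` Z \<subseteq> A"
      using Z(1) by (auto simp: B_def)
    fix x y assume "x \<in> (+) p ` Z" "y \<in> (+) p ` Z"
    then obtain z z' where "z \<in> Z" "z' \<in> Z" "x = p + z" "y = p + z'" by blast
    moreover from this have "lattice_point z" "lattice_point z'" using Z(1) lat by auto
    ultimately show "lattice_point (x - y)" by (simp add: lattice_point_diff)
  qed
qed

text \<open>A case of the matrix determinant lemma. Enlarging \<open>J\<close> by \<open>k\<close>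
  changes only column \<open>k\<close>; nonnegativity of \<open>u\<close> keeps
  \<open>1 + \<sigma>\<close> away from 0.\<close>

lemma det_identity_plus_rank_one:
  fixes u :: "real^'n"
  assumes "finite J" "\<And>i. 0 \<le> u $ i"
  shows "det (\<chi> i j. (if i = j then 1 else 0) + (if j \<in> J then u $ i else 0)) = 1 + (\<Sum>i\<in>J. u $ i)"
  using \<open>finite J\<close>
proof (induction J rule: finite_induct)
  case empty
  have "(\<chi> i j. (if i = j then 1 else 0) + (if j \<in> {} then u $ i else 0)) = (mat 1 :: real^'n^'n)"
    by (simp add: mat_def vec_eq_iff)
  then show ?case by simp
next
  case (insert k J)
  define A :: "real^'n^'n" where "A = (\<chi> i j. (if i = j then 1 else 0) + (if j \<in> J then u $ i else 0))"
  define \<sigma> where "\<sigma> = (\<Sum>i\<in>J. u $ i)"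
  \<comment> \<open>Chosen such that \<open>A *v x\<close> is the new column \<open>k\<close>, so Cramer's rule gives the determinant.\<close>
  define x :: "real^'n" where "x = (\<chi> i. u $ i / (1 + \<sigma>) + (if i = k then 1 else 0))"
  have \<sigma>: "\<sigma> \<ge> 0" unfolding \<sigma>_def by (intro sum_nonneg assms)
  have "(\<Sum>j\<in>J. x $ j) = (\<Sum>j\<in>J. u $ j / (1 + \<sigma>))"
    using insert.hyps by (intro sum.cong) (auto simp: x_def)
  then have xJ: "(\<Sum>j\<in>J. x $ j) = \<sigma> / (1 + \<sigma>)"
    by (simp add: \<sigma>_def sum_divide_distrib)
  have Ax: "(A *v x) $ i = (if i = k then 1 else 0) + u $ i" for i
  proof -
    have "(A *v x) $ i = (\<Sum>j\<in>UNIV. (if i = j then x $ j else 0) + (if j \<in> J then u $ i * x $ j else 0))"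
      unfolding matrix_vector_mult_def A_def by (auto intro!: sum.cong simp: algebra_simps)
    also have "\<dots> = x $ i + u $ i * (\<Sum>j\<in>J. x $ j)"
      by (simp add: sum.distrib sum.delta' sum.If_cases sum_distrib_left)
    also have "\<dots> = (if i = k then 1 else 0) + u $ i * (1 / (1 + \<sigma>) + \<sigma> / (1 + \<sigma>))"
      unfolding xJ by (simp add: x_def algebra_simps)
    also have "1 / (1 + \<sigma>) + \<sigma> / (1 + \<sigma>) = 1"
      using \<sigma> by (simp add: add_divide_distrib[symmetric])
    finally show ?thesis by simp
  qed
  have "(\<chi> i j. (if i = j then 1 else 0) + (if j \<in> insert k J then u $ i else 0)) =
      (\<chi> i j. if j = k then (A *v x) $ i else A $ i $ j)"
    unfolding Ax using insert.hyps by (simp add: A_def vec_eq_iff)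
  then have "det (\<chi> i j. (if i = j then 1 else 0) + (if j \<in> insert k J then u $ i else 0)) = x $ k * det A"
    by (simp only: cramer_lemma)
  also have "det A = 1 + \<sigma>" using insert.IH by (simp add: A_def \<sigma>_def)
  also have "x $ k * (1 + \<sigma>) = 1 + \<sigma> + u $ k"
    using \<sigma> by (simp add: x_def field_simps)
  finally show ?case using insert.hyps by (simp add: \<sigma>_def)
qed

lemma measure_lebesgue_box_0_cart:
  fixes c :: "real^'n"
  assumes "\<And>i. 0 < c $ i"
  shows "measure lebesgue (box 0 c) = (\<Prod>i\<in>UNIV. c $ i)"
proof -
  have "0 \<le> c $ i" for i using assms[of i] by simp
  then have "cbox 0 c \<noteq> {}" by (simp add: interval_eq_empty_cart not_less)
  then have "measure lborel (cbox 0 c) = (\<Prod>i\<in>UNIV. c $ i)" by (simp add: content_cbox_cart)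
  moreover have "measure lborel (box 0 c) = measure lborel (cbox 0 c)"
    by (simp only: measure_lborel_box_eq measure_lborel_cbox_eq)
  ultimately show ?thesis by simp
qed

text \<open>The image of a box under \<open>h\<close> has volume
  \<open>(\<Prod>i\<in>J. y i) / T > 1\<close>, so Blichfeldt's principle yields two of its points
  with a nonzero lattice difference \<open>n\<close>.\<close>

lemma exists_integer_combination:
  fixes \<beta> :: "real^'n"
  assumes \<beta>: "\<And>i. 0 < \<beta> $ i" and J: "(\<Sum>i\<in>J. \<beta> $ i) < 1" and y: "\<And>i. i \<in> J \<Longrightarrow> 0 < y i"
    and less: "1 - (\<Sum>i\<in>J. \<beta> $ i) < (\<Prod>i\<in>J. y i)"
  obtains n :: "real^'n" where "lattice_point n" "n \<noteq> 0" "\<And>i. i \<notin> J \<Longrightarrow> n $ i = 0"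
    "(\<Sum>i\<in>UNIV. n $ i) \<le> 0" "\<And>i. i \<in> J \<Longrightarrow> \<bar>n $ i - (\<Sum>i\<in>UNIV. n $ i) * \<beta> $ i\<bar> < y i"
proof -
  \<comment> \<open>\<open>h\<close> inverts \<open>n \<mapsto> n - (\<Sum>i\<in>J. n $ i) \<beta>\<close> on the coordinates in \<open>J\<close>; off \<open>J\<close> the unit box
    forces \<open>n $ i = 0\<close>.\<close>
  define T where "T = 1 - (\<Sum>i\<in>J. \<beta> $ i)"
  define u :: "real^'n" where "u = (\<chi> i. if i \<in> J then \<beta> $ i / T else 0)"
  define h :: "real^'n \<Rightarrow> real^'n" where "h t = (\<chi> i. t $ i + u $ i * (\<Sum>j\<in>J. t $ j))" for t
  define c :: "real^'n" where "c = (\<chi> i. if i \<in> J then y i else 1)"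
  have T: "T > 0" using J by (simp add: T_def)
  have lin: "linear h"
    by (rule linearI) (simp_all add: h_def vec_eq_iff sum.distrib sum_distrib_left algebra_simps)
  have "(\<Sum>j\<in>J. axis i 1 $ j) = (if i \<in> J then 1 else (0::real))" for i
    by (simp add: axis_def sum.delta')
  then have "matrix h = (\<chi> i j. (if i = j then 1 else 0) + (if j \<in> J then u $ i else 0))"
    unfolding matrix_def h_def by (simp add: vec_eq_iff axis_def)
  moreover have "0 \<le> u $ i" for i using \<beta>[of i] T by (simp add: u_def)
  ultimately have "det (matrix h) = 1 + (\<Sum>i\<in>J. u $ i)"
    using det_identity_plus_rank_one[of J u] by simp
  also have "(\<Sum>i\<in>J. u $ i) = (1 - T) / T"
    by (simp add: u_def T_def sum_divide_distrib)
  finally have det: "det (matrix h) = 1 / T" using T by (simp add: field_simps)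
  have c: "0 < c $ i" for i using y by (simp add: c_def)
  have "(\<Prod>i\<in>UNIV. c $ i) = (\<Prod>i\<in>J. y i)"
    by (simp add: c_def prod.If_cases)
  then have "measure lebesgue (h ` box 0 c) = (\<Prod>i\<in>J. y i) / T"
    using measure_lebesgue_linear_image(2)[OF lin, of "box 0 c"] measure_lebesgue_box_0_cart[OF c] det T
    by simp
  then have "real 1 < measure lebesgue (h ` box 0 c)"
    using less T by (simp add: T_def)
  moreover have "h ` box 0 c \<in> lmeasurable"
    by (rule measure_lebesgue_linear_image(1)[OF lin]) simp
  moreover have "bounded (h ` box 0 c)"
    using lin by (intro bounded_linear_image bounded_box) (simp add: linear_conv_bounded_linear)
  ultimately obtain P where P: "finite P" "card P = 1 + 1" "P \<subseteq> h ` box 0 c"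
      "\<And>x y. x \<in> P \<Longrightarrow> y \<in> P \<Longrightarrow> lattice_point (x - y)"
    using blichfeldt[of "h ` box 0 c" 1] by metis
  then obtain p p' where pp: "P = {p, p'}" "p \<noteq> p'"
    using card_2_iff[of P] by auto
  \<comment> \<open>The order of the two points is chosen so that their difference has nonpositive
    coordinate sum.\<close>
  obtain q q' where qq: "q \<in> P" "q' \<in> P" "q \<noteq> q'" "(\<Sum>i\<in>UNIV. (q - q') $ i) \<le> 0"
  proof (cases "(\<Sum>i\<in>UNIV. (p - p') $ i) \<le> 0")
    case True
    then show ?thesis using that[of p p'] pp by blast
  next
    case False
    have "(\<Sum>i\<in>UNIV. (p' - p) $ i) = - (\<Sum>i\<in>UNIV. (p - p') $ i)"
      by (simp add: sum_subtractf)
    then show ?thesis using that[of p' p] pp False by simp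
  qed
  obtain t t' where t: "t \<in> box 0 c" "q = h t" "t' \<in> box 0 c" "q' = h t'"
    using qq P(3) by blast
  define s where "s = t - t'"
  have n: "q - q' = h s" using t linear_diff[OF lin] by (simp add: s_def)
  have s: "\<bar>s $ i\<bar> < c $ i" for i
    using t(1,3) by (auto simp: mem_box_cart s_def abs_less_iff dest!: spec[of _ i])
  \<comment> \<open>Hence the rank-one term of \<open>h s\<close> is, on \<open>J\<close>, the
    coordinate sum of \<open>h s\<close> times \<beta>; subtracting it leaves
    \<open>s\<close>.\<close>
  have sum_n: "(\<Sum>i\<in>UNIV. h s $ i) = (\<Sum>j\<in>J. s $ j) / T" if supp: "\<And>i. i \<notin> J \<Longrightarrow> h s $ i = 0"
  proof -
    have "(\<Sum>i\<in>UNIV. h s $ i) = (\<Sum>i\<in>J. h s $ i)"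
      by (rule sum.mono_neutral_right) (auto simp: supp)
    also have "\<dots> = (\<Sum>i\<in>J. s $ i) + (\<Sum>i\<in>J. u $ i) * (\<Sum>j\<in>J. s $ j)"
      by (simp add: h_def sum.distrib sum_distrib_right)
    also have "\<dots> = (\<Sum>j\<in>J. s $ j) * (1 + (1 - T) / T)"
      using \<open>(\<Sum>i\<in>J. u $ i) = (1 - T) / T\<close> by (simp add: algebra_simps)
    also have "1 + (1 - T) / T = 1 / T" using T by (simp add: field_simps)
    finally show ?thesis by simp
  qed
  show thesis
  proof
    show lat: "lattice_point (h s)" using P(4)[OF qq(1,2)] n by simp
    show "h s \<noteq> 0" using qq(3) n by auto
    show supp: "h s $ i = 0" if "i \<notin> J" for i
    proof -
      have "h s $ i = s $ i" using that by (simp add: h_def u_def)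
      moreover have "\<bar>s $ i\<bar> < 1" using s[of i] that by (simp add: c_def)
      moreover have "h s $ i \<in> \<int>" using lat by (simp add: lattice_point_def)
      ultimately show ?thesis using Ints_nonzero_abs_less1 by metis
    qed
    show "(\<Sum>i\<in>UNIV. h s $ i) \<le> 0" using qq(4) n by simp
    show "\<bar>h s $ i - (\<Sum>i\<in>UNIV. h s $ i) * \<beta> $ i\<bar> < y i" if "i \<in> J" for i
    proof -
      have sn: "(\<Sum>i\<in>UNIV. h s $ i) = (\<Sum>j\<in>J. s $ j) / T"
        by (rule sum_n) (rule supp)
      have "h s $ i - (\<Sum>i\<in>UNIV. h s $ i) * \<beta> $ i = s $ i"
        unfolding sn using that by (simp add: h_def u_def mult.commute)
      then show ?thesis using s[of i] that by (simp add: c_def)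
    qed
  qed
qed

lemma exists_lattice_translates:
  fixes f :: "real^'n \<Rightarrow> real^'n" and \<beta> :: "real^'n"
  assumes lin: "linear f" and \<beta>: "\<And>i. 0 < \<beta> $ i"
    and k: "real k < \<bar>det (matrix f)\<bar> * (\<Prod>i\<in>UNIV. \<beta> $ i)"
  obtains Z where "finite Z" "card Z = k + 1"
    "\<And>z. z \<in> Z \<Longrightarrow> lattice_point (f z) \<and> (\<forall>i. z $ i < \<beta> $ i) \<and> 0 \<le> (\<Sum>i\<in>UNIV. z $ i)"
proof -
  have "real k < measure lebesgue (f ` box 0 \<beta>)"
    using measure_lebesgue_linear_image(2)[OF lin, of "box 0 \<beta>"] measure_lebesgue_box_0_cart[OF \<beta>] k by simp
  moreover have "f ` box 0 \<beta> \<in> lmeasurable"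
    by (rule measure_lebesgue_linear_image(1)[OF lin]) simp
  moreover have "bounded (f ` box 0 \<beta>)"
    using lin by (intro bounded_linear_image bounded_box) (simp add: linear_conv_bounded_linear)
  ultimately obtain P where P: "finite P" "card P = k + 1" "P \<subseteq> f ` box 0 \<beta>"
      "\<And>x y. x \<in> P \<Longrightarrow> y \<in> P \<Longrightarrow> lattice_point (x - y)"
    using blichfeldt[of "f ` box 0 \<beta>" k] by metis
  define g where "g = inv_into (box 0 \<beta>) f"
  have g: "g p \<in> box 0 \<beta> \<and> f (g p) = p" if "p \<in> P" for p
    using P(3) that unfolding g_def by (auto intro: inv_into_into f_inv_into_f)
  define w where "w p = (\<Sum>i\<in>UNIV. g p $ i)" for p
  have "P \<noteq> {}" using P(2) by auto
  then obtain p where p: "p \<in> P" "\<And>p'. p' \<in> P \<Longrightarrow> w p \<le> w p'"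
    using ex_is_arg_min_if_finite[OF P(1), of w] by (auto simp: is_arg_min_linorder)
  show thesis
  proof
    show "finite ((\<lambda>p'. g p' - g p) ` P)" using P(1) by simp
    have "inj_on (\<lambda>p'. g p' - g p) P" using g by (auto simp: inj_on_def) metis
    then show "card ((\<lambda>p'. g p' - g p) ` P) = k + 1" using P(2) by (simp add: card_image)
    fix z assume "z \<in> (\<lambda>p'. g p' - g p) ` P"
    then obtain p' where p': "p' \<in> P" "z = g p' - g p" by auto
    have "f z = p' - p" using g[OF p'(1)] g[OF p(1)] p'(2) linear_diff[OF lin] by simp
    moreover have "z $ i < \<beta> $ i" for i
      using g[OF p'(1)] g[OF p(1)] p'(2) by (auto simp: mem_box_cart dest!: spec[of _ i])
    moreover have "0 \<le> (\<Sum>i\<in>UNIV. z $ i)"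
      using p(2)[OF p'(1)] by (simp add: p'(2) w_def sum_subtractf)
    ultimately show "lattice_point (f z) \<and> (\<forall>i. z $ i < \<beta> $ i) \<and> 0 \<le> (\<Sum>i\<in>UNIV. z $ i)"
      using P(4)[OF p'(1) p(1)] by simp
  qed
qed

section \<open>Lattice simplices\<close>

lemma affinely_independent_zero:
  fixes V :: "'a::real_vector set"
  assumes "finite V" "\<not> affine_dependent V" "sum g V = 0" "(\<Sum>v\<in>V. g v *\<^sub>R v) = 0" "v \<in> V"
  shows "g v = 0"
  using assms affine_dependent_explicit_finite[OF assms(1)] by blast

lemma measure_lebesgue_std_simplex:
  "measure lebesgue (convex hull (insert 0 Basis) :: (real^'n) set) = 1 / fact CARD('n)"
proof -
  have "compact (convex hull (insert 0 Basis) :: (real^'n) set)"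
    by (intro finite_imp_compact_convex_hull) auto
  then have "(convex hull (insert 0 Basis) :: (real^'n) set) \<in> sets lborel"
    by (simp add: borel_compact)
  then have "measure lebesgue (convex hull (insert 0 Basis) :: (real^'n) set) =
      measure lborel (convex hull (insert 0 Basis) :: (real^'n) set)"
    by (rule measure_completion)
  then show ?thesis by (simp add: content_std_simplex)
qed

lemma ex_antimono_enumeration:
  fixes g :: "'n::finite \<Rightarrow> real"
  obtains e where "bij_betw e {..<CARD('n)} (UNIV :: 'n set)"
    "\<And>i. Suc i < CARD('n) \<Longrightarrow> g (e (Suc i)) \<le> g (e i)"
proof -
  obtain xs :: "'n list" where xs: "set xs = UNIV" "distinct xs"
    using finite_distinct_list[of "UNIV :: 'n set"] by auto
  define ys where "ys = sort_key (\<lambda>i. - g i) xs"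
  have ys: "set ys = UNIV" "distinct ys" "length ys = CARD('n)" "sorted (map (\<lambda>i. - g i) ys)"
    using xs distinct_card[OF xs(2)] by (auto simp: ys_def)
  show thesis
  proof
    show "bij_betw (\<lambda>i. ys ! i) {..<CARD('n)} UNIV"
      using bij_betw_nth[OF ys(2), of "{..<CARD('n)}" UNIV] ys by simp
    show "g (ys ! Suc i) \<le> g (ys ! i)" if "Suc i < CARD('n)" for i
      using sorted_nth_mono[OF ys(4), of i "Suc i"] that ys(3) by simp
  qed
qed

text \<open>With \<open>f\<close> sending the unit vectors to the edges at a vertex
  \<open>q\<close>, \<open>d!\<close> times the volume is the absolute determinant of
  \<open>f\<close>. Its product with the coordinates \<beta> is at most \<open>k\<close>, and those
  coordinates have a product bounded below. Here \<open>sylv_prod (CARD('n) - 1)\<close> is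
  \<open>sylvester d - 1\<close>.\<close>

theorem lattice_simplex_volume_le:
  fixes V :: "(real^'n) set"
  assumes V: "finite V" "card V = CARD('n) + 1" "\<not> affine_dependent V" "\<And>v. v \<in> V \<Longrightarrow> lattice_point v"
    and k: "card {x \<in> interior (convex hull V). lattice_point x} = k" "1 \<le> k"
  shows "measure lebesgue (convex hull V) \<le>
    real k * real (CARD('n) + 1) * real (sylv_prod (CARD('n) - 1)) ^ 2 / fact CARD('n)"
proof -

  \<comment> \<open>The extremal interior lattice point\<close>
  define I where "I = {x \<in> interior (convex hull V). lattice_point x}"
  have I: "card I = k" using k(1) by (simp add: I_def)
  \<comment> \<open>An infinite set would have \<open>card\<close> 0, so \<open>1 \<le> k\<close>
    gives finiteness as well as nonemptiness.\<close>
  then have I: "finite I" "I \<noteq> {}" "card I = k"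
    using k(2) by (auto intro: card_ge_0_finite)
  have interior: "x \<in> interior (convex hull V) \<longleftrightarrow>
      (\<exists>u. (\<forall>v\<in>V. 0 < u v) \<and> sum u V = 1 \<and> (\<Sum>v\<in>V. u v *\<^sub>R v) = x)" for x
    using V by (simp add: interior_convex_hull_explicit_minimal)
  \<comment> \<open>Barycentric coordinates of \<open>x\<close>, meaningful on \<open>I\<close> and
    unique there by affine independence.\<close>
  define U where "U x = (SOME u. (\<forall>v\<in>V. 0 < u v) \<and> sum u V = 1 \<and> (\<Sum>v\<in>V. u v *\<^sub>R v) = x)" for x
  have U: "(\<forall>v\<in>V. 0 < U x v) \<and> sum (U x) V = 1 \<and> (\<Sum>v\<in>V. U x v *\<^sub>R v) = x" if "x \<in> I" for x
  proof -
    have "\<exists>u. (\<forall>v\<in>V. 0 < u v) \<and> sum u V = 1 \<and> (\<Sum>v\<in>V. u v *\<^sub>R v) = x"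
      using that interior by (simp add: I_def)
    then show ?thesis unfolding U_def by (rule someI_ex)
  qed
  have U_unique: "U x v = u v" if "x \<in> I" "sum u V = 1" "(\<Sum>v\<in>V. u v *\<^sub>R v) = x" "v \<in> V" for x u v
    using affinely_independent_zero[OF V(1,3), of "\<lambda>v. U x v - u v" v] U[OF that(1)] that
    by (simp add: sum_subtractf scaleR_diff_left)
  have "V \<noteq> {}" using V(2) by auto
  define mc where "mc x = Min (U x ` V)" for x
  obtain x0 where x0: "x0 \<in> I" "\<And>x. x \<in> I \<Longrightarrow> mc x \<le> mc x0"
    using ex_is_arg_min_if_finite[OF I(1,2), of "\<lambda>x. - mc x"] by (auto simp: is_arg_min_linorder)
  define I' where "I' = {x \<in> I. mc x = mc x0}"
  have "finite I'" "I' \<noteq> {}" using I x0 by (auto simp: I'_def)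
  then obtain x where x': "x \<in> I'" "\<And>x'. x' \<in> I' \<Longrightarrow> norm x' \<le> norm x"
    using ex_is_arg_min_if_finite[of I' "\<lambda>x. - norm x"] by (auto simp: is_arg_min_linorder)
  define \<epsilon> where "\<epsilon> = mc x"
  have x: "x \<in> I" "\<And>x'. x' \<in> I \<Longrightarrow> mc x' \<le> \<epsilon>" "\<And>x'. x' \<in> I \<Longrightarrow> mc x' = \<epsilon> \<Longrightarrow> norm x' \<le> norm x"
    using x' x0 by (auto simp: I'_def \<epsilon>_def)
  have "\<epsilon> \<in> U x ` V" unfolding \<epsilon>_def mc_def using V(1) \<open>V \<noteq> {}\<close> by (intro Min_in) auto
  \<comment> \<open>A vertex carrying the smallest coordinate becomes the origin. The remaining
    coordinates \<beta> are then all at least \<epsilon> and sum to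
    \<open>1 - \<epsilon>\<close>.\<close>
  then obtain q where q: "q \<in> V" "U x q = \<epsilon>" by blast
  have U_ge: "\<epsilon> \<le> U x v" if "v \<in> V" for v
    using V(1) that by (simp add: \<epsilon>_def mc_def)
  have \<epsilon>: "\<epsilon> > 0" using U[OF x(1)] q by auto

  \<comment> \<open>Affine coordinates at the vertex \<open>q\<close>\<close>
  obtain \<sigma> :: "'n \<Rightarrow> real^'n" where \<sigma>: "bij_betw \<sigma> UNIV (V - {q})"
    using finite_same_card_bij[of "UNIV :: 'n set" "V - {q}"] V q by auto
  have \<sigma>V: "\<sigma> i \<in> V" "\<sigma> i \<noteq> q" for i using \<sigma> by (auto simp: bij_betw_def)
  have sum_V: "sum g V = g q + (\<Sum>i\<in>UNIV. g (\<sigma> i))" for g :: "real^'n \<Rightarrow> 'b::ab_group_add"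
    using sum.remove[OF V(1) q(1), of g] sum.reindex_bij_betw[OF \<sigma>, of g] by simp
  define \<tau> where "\<tau> = inv \<sigma>"
  have \<tau>: "\<tau> (\<sigma> i) = i" for i using \<sigma> by (auto simp: \<tau>_def bij_betw_def)
  define f :: "real^'n \<Rightarrow> real^'n" where "f t = (\<Sum>i\<in>UNIV. t $ i *\<^sub>R (\<sigma> i - q))" for t
  have lin: "linear f"
    by (rule linearI) (simp_all add: f_def scaleR_left.add sum.distrib scaleR_sum_right)
  \<comment> \<open>\<open>W t\<close> are the barycentric coordinates of \<open>q + f t\<close>.\<close>
  define W where "W t v = (if v = q then 1 - (\<Sum>i\<in>UNIV. t $ i) else t $ \<tau> v)" for t :: "real^'n" and v
  have W: "W t q = 1 - (\<Sum>i\<in>UNIV. t $ i)" "W t (\<sigma> i) = t $ i" for t i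
    using \<sigma>V[of i] \<tau>[of i] by (auto simp: W_def)
  have W_sum: "sum (W t) V = 1" "(\<Sum>v\<in>V. W t v *\<^sub>R v) = q + f t" for t
  proof -
    show "sum (W t) V = 1" unfolding sum_V W by simp
    have "(\<Sum>v\<in>V. W t v *\<^sub>R v) = (1 - (\<Sum>i\<in>UNIV. t $ i)) *\<^sub>R q + (\<Sum>i\<in>UNIV. t $ i *\<^sub>R \<sigma> i)"
      unfolding sum_V W ..
    then show "(\<Sum>v\<in>V. W t v *\<^sub>R v) = q + f t"
      by (simp add: f_def scaleR_diff_left scaleR_diff_right sum_subtractf scaleR_sum_left)
  qed
  have V_cases: "v = q \<or> (\<exists>i. v = \<sigma> i)" if "v \<in> V" for v
    using that \<sigma> by (auto simp: bij_betw_def)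
  have f_inj: "t = t'" if "f t = f t'" for t t'
  proof -
    have "W t v - W t' v = 0" if "v \<in> V" for v
      by (rule affinely_independent_zero[OF V(1,3) _ _ that, of "\<lambda>v. W t v - W t' v"])
        (use W_sum \<open>f t = f t'\<close> in \<open>simp_all add: sum_subtractf scaleR_diff_left\<close>)
    from this[OF \<sigma>V(1)] show ?thesis by (simp add: W vec_eq_iff)
  qed
  have mem_I: "q + f t \<in> I" if "\<And>i. 0 < t $ i" "(\<Sum>i\<in>UNIV. t $ i) < 1" "lattice_point (f t)" for t
  proof -
    have "\<forall>v\<in>V. 0 < W t v" using V_cases that(1,2) W by fastforce
    then have "q + f t \<in> interior (convex hull V)"
      using W_sum[of t] interior by blast
    moreover have "lattice_point (q + f t)"
      using that(3) V(4)[OF q(1)] by (simp add: lattice_point_def)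
    ultimately show ?thesis by (simp add: I_def)
  qed
  have mc_W: "mc (q + f t) = Min (W t ` V)" if "q + f t \<in> I" for t
    unfolding mc_def using U_unique[OF that W_sum] by (metis image_cong)
  define \<beta> :: "real^'n" where "\<beta> = (\<chi> i. U x (\<sigma> i))"
  have \<beta>_pos: "0 < \<beta> $ i" and \<beta>_ge: "\<epsilon> \<le> \<beta> $ i" for i
    using U[OF x(1)] \<sigma>V U_ge by (auto simp: \<beta>_def)
  have \<beta>_sum: "(\<Sum>i\<in>UNIV. \<beta> $ i) = 1 - \<epsilon>"
    using U[OF x(1)] q(2) sum_V[of "U x"] by (simp add: \<beta>_def)
  have x_eq: "x = q + f \<beta>"
  proof -
    have "W \<beta> v = U x v" if "v \<in> V" for v
      using V_cases[OF that] W \<beta>_sum q(2) by (auto simp: \<beta>_def)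
    then have "(\<Sum>v\<in>V. W \<beta> v *\<^sub>R v) = (\<Sum>v\<in>V. U x v *\<^sub>R v)" by simp
    then show ?thesis using U[OF x(1)] W_sum(2)[of \<beta>] by simp
  qed
  have f\<beta>: "lattice_point (f \<beta>)"
    using x(1) V(4)[OF q(1)] lattice_point_diff[of x q] by (simp add: I_def x_eq)
  have f_lattice: "lattice_point (f n)" if "lattice_point n" for n
    using that V(4) \<sigma>V(1) q(1) unfolding lattice_point_def f_def
    by (auto intro!: Ints_sum Ints_mult Ints_diff)

  \<comment> \<open>Determinant times product of coordinates is at most \<open>k\<close>\<close>
  have volume: "\<bar>det (matrix f)\<bar> * (\<Prod>i\<in>UNIV. \<beta> $ i) \<le> real k"
  proof (rule ccontr)
    assume "\<not> ?thesis"
    then obtain Z where Z: "finite Z" "card Z = k + 1"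
      "\<And>z. z \<in> Z \<Longrightarrow> lattice_point (f z) \<and> (\<forall>i. z $ i < \<beta> $ i) \<and> 0 \<le> (\<Sum>i\<in>UNIV. z $ i)"
      using exists_lattice_translates[OF lin \<beta>_pos, of k] by (metis not_le)
    \<comment> \<open>These are the points \<open>x - f z\<close>: the vector
      \<open>\<beta> - z\<close> is positive and its sum does not exceed that of \<beta>, so they
      stay in the interior.\<close>
    have "(\<lambda>z. q + f (\<beta> - z)) ` Z \<subseteq> I"
    proof
      fix p assume "p \<in> (\<lambda>z. q + f (\<beta> - z)) ` Z"
      then obtain z where z: "z \<in> Z" "p = q + f (\<beta> - z)" by auto
      have "lattice_point (f (\<beta> - z))"
        using Z(3)[OF z(1)] f\<beta> by (simp add: linear_diff[OF lin] lattice_point_diff)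
      then show "p \<in> I"
        unfolding z(2) using Z(3)[OF z(1)] \<beta>_sum \<epsilon> by (intro mem_I) (auto simp: sum_subtractf)
    qed
    moreover have "inj_on (\<lambda>z. q + f (\<beta> - z)) Z"
      by (auto simp: inj_on_def dest!: f_inj)
    ultimately have "k + 1 \<le> k"
      using card_mono[OF I(1)] I(3) Z(2) by (metis card_image)
    then show False by simp
  qed

  \<comment> \<open>Product inequalities from the extremal choice\<close>
  have product: "(\<Prod>i\<in>J. \<beta> $ i - \<epsilon>) \<le> 1 - (\<Sum>i\<in>J. \<beta> $ i)" for J
  proof (rule ccontr)
    assume neg: "\<not> ?thesis"
    have "(\<Sum>i\<in>J. \<beta> $ i) \<le> (\<Sum>i\<in>UNIV. \<beta> $ i)"
      using \<beta>_pos by (intro sum_mono2) (auto simp: less_imp_le)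
    then have J: "(\<Sum>i\<in>J. \<beta> $ i) < 1" using \<beta>_sum \<epsilon> by simp
    have pos: "0 < \<beta> $ i - \<epsilon>" if "i \<in> J" for i
    proof (rule ccontr)
      assume "\<not> ?thesis"
      then have "\<beta> $ i - \<epsilon> = 0" using \<beta>_ge[of i] by simp
      then have "(\<Prod>i\<in>J. \<beta> $ i - \<epsilon>) = 0" using that by (metis finite prod_zero)
      then show False using neg J by linarith
    qed
    obtain n :: "real^'n" where n: "lattice_point n" "n \<noteq> 0" "\<And>i. i \<notin> J \<Longrightarrow> n $ i = 0"
        "(\<Sum>i\<in>UNIV. n $ i) \<le> 0" "\<And>i. i \<in> J \<Longrightarrow> \<bar>n $ i - (\<Sum>i\<in>UNIV. n $ i) * \<beta> $ i\<bar> < \<beta> $ i - \<epsilon>"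
      using exists_integer_combination[OF \<beta>_pos J, of "\<lambda>i. \<beta> $ i - \<epsilon>"] pos neg by (metis not_le)
    define s where "s = (\<Sum>i\<in>UNIV. n $ i)"
    \<comment> \<open>As \<open>s\<close> is an integer and \<open>f \<beta> = x - q\<close>,
      \<open>f z\<close> is a lattice vector. Moving \<open>x\<close> by it changes each coordinate
      in \<open>J\<close> by less than its excess over \<epsilon>, multiplies those outside
      \<open>J\<close> by \<open>1 - s \<ge> 1\<close>, and turns the coordinate of \<open>q\<close>
      into \<open>(1 - s) * \<epsilon>\<close>.\<close>
    define z where "z = n - s *\<^sub>R \<beta>"
    have "s \<in> \<int>" using n(1) by (auto simp: s_def lattice_point_def)
    then have fz: "lattice_point (f z)"
      unfolding z_def linear_diff[OF lin] linear_scale[OF lin]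
      using f_lattice[OF n(1)] f\<beta> by (intro lattice_point_diff) (auto simp: lattice_point_def)
    have s: "s \<le> 0" using n(4) by (simp add: s_def)
    have zJ: "\<bar>z $ i\<bar> < \<beta> $ i - \<epsilon>" if "i \<in> J" for i using n(5)[OF that] by (simp add: z_def s_def)
    have znJ: "z $ i = - s * \<beta> $ i" if "i \<notin> J" for i using n(3)[OF that] by (simp add: z_def)
    have z_sum: "(\<Sum>i\<in>UNIV. z $ i) = s * \<epsilon>"
    proof -
      have "(\<Sum>i\<in>UNIV. z $ i) = s - s * (\<Sum>i\<in>UNIV. \<beta> $ i)"
        by (simp add: z_def s_def sum_subtractf sum_distrib_left)
      then show ?thesis by (simp add: \<beta>_sum algebra_simps)
    qed
    have z_ge: "- s * \<epsilon> \<le> z $ i" if "i \<notin> J" for i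
      unfolding znJ[OF that] using s \<beta>_ge[of i] by (intro mult_left_mono) auto
    have in_I: "x + f w \<in> I \<and> mc (x + f w) = Min (W (\<beta> + w) ` V)"
      if "\<And>i. \<epsilon> \<le> \<beta> $ i + w $ i" "(\<Sum>i\<in>UNIV. w $ i) \<le> 0" "lattice_point (f w)" for w
    proof -
      have eq: "x + f w = q + f (\<beta> + w)" by (simp add: x_eq linear_add[OF lin])
      have "lattice_point (f (\<beta> + w))"
        using f\<beta> that(3) by (simp add: linear_add[OF lin] lattice_point_def)
      moreover have "0 < (\<beta> + w) $ i" for i using that(1)[of i] \<epsilon> by simp
      moreover have "(\<Sum>i\<in>UNIV. (\<beta> + w) $ i) < 1" using that(2) \<beta>_sum \<epsilon> by (simp add: sum.distrib)
      ultimately show ?thesis using mem_I mc_W unfolding eq by blast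
    qed
    have shifted: "\<epsilon> \<le> \<beta> $ i + z $ i" for i
    proof (cases "i \<in> J")
      case True then show ?thesis using zJ[OF True] by simp
    next
      case False
      have "0 \<le> - s * \<epsilon>" using s \<epsilon> by (intro mult_nonneg_nonneg) auto
      then show ?thesis using z_ge[OF False] \<beta>_ge[of i] by linarith
    qed
    have sz: "(\<Sum>i\<in>UNIV. z $ i) \<le> 0" using z_sum s \<epsilon> by (simp add: mult_nonpos_nonneg)
    note xz = in_I[OF shifted sz fz]
    \<comment> \<open>If \<open>s < 0\<close>, then \<open>x + f z\<close> has all coordinates above \<open>\<epsilon>\<close>; if \<open>s = 0\<close>, then one of \<open>x \<plusminus> f z\<close>
      has larger norm than \<open>x\<close>, by the parallelogram law.\<close>
    have "s = 0"
    proof (rule ccontr)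
      assume "s \<noteq> 0"
      then have s0: "0 < - s * \<epsilon>" using s \<epsilon> by (intro mult_pos_pos) auto
      have "\<epsilon> < W (\<beta> + z) v" if "v \<in> V" for v
      proof -
        have "\<epsilon> < W (\<beta> + z) (\<sigma> i)" for i
        proof (cases "i \<in> J")
          case True then show ?thesis using zJ[OF True] by (simp add: W)
        next
          case False then show ?thesis using z_ge[OF False] \<beta>_ge[of i] s0 by (simp add: W)
        qed
        moreover have "\<epsilon> < W (\<beta> + z) q"
          using s0 by (simp add: W sum.distrib \<beta>_sum z_sum)
        ultimately show ?thesis using V_cases[OF that] by auto
      qed
      then have "\<epsilon> < mc (x + f z)" using xz V(1) \<open>V \<noteq> {}\<close> by simp
      then show False using x(2) xz by fastforce
    qed
    then have zn: "z = n" by (simp add: z_def)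
    have zsum: "(\<Sum>i\<in>UNIV. z $ i) = 0" using z_sum \<open>s = 0\<close> by simp
    have W_ge: "\<epsilon> \<le> W (\<beta> + w) v" if "\<And>i. \<epsilon> \<le> \<beta> $ i + w $ i" "(\<Sum>i\<in>UNIV. w $ i) \<le> 0" "v \<in> V" for w v
      using V_cases[OF that(3)] that(1,2) \<beta>_sum by (auto simp: W sum.distrib)
    have norm_le: "norm (x + f w) \<le> norm x"
      if w: "\<And>i. \<epsilon> \<le> \<beta> $ i + w $ i" "(\<Sum>i\<in>UNIV. w $ i) \<le> 0" "lattice_point (f w)" for w
    proof -
      have "\<epsilon> \<le> mc (x + f w)" using in_I[OF w] W_ge[OF w(1,2)] V(1) \<open>V \<noteq> {}\<close> by simp
      then show ?thesis using x(2,3)[of "x + f w"] in_I[OF w] by simp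
    qed
    \<comment> \<open>For \<open>s = 0\<close> the vector \<open>z\<close> vanishes outside
      \<open>J\<close>, and the bounds on \<open>J\<close> are symmetric, so \<open>- z\<close> is
      as admissible as \<open>z\<close>.\<close>
    have "\<epsilon> \<le> \<beta> $ i + (- z) $ i" for i
      using zJ[of i] znJ[of i] \<open>s = 0\<close> \<beta>_ge[of i] by (cases "i \<in> J") auto
    moreover have "lattice_point (f (- z))"
      using fz by (simp add: linear_neg[OF lin] lattice_point_def)
    ultimately have "norm (x + f (- z)) \<le> norm x"
      using zsum by (intro norm_le) (auto simp: sum_negf)
    then have "(norm (x - f z))\<^sup>2 \<le> (norm x)\<^sup>2" by (simp add: linear_neg[OF lin])
    moreover have "(norm (x + f z))\<^sup>2 \<le> (norm x)\<^sup>2" using norm_le[OF shifted sz fz] by simp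
    ultimately have "f z \<bullet> f z \<le> 0"
      by (simp add: power2_norm_eq_inner inner_simps inner_commute)
    then have "f z = f 0" by (metis inner_gt_zero_iff linear_0[OF lin] not_le)
    then show False using f_inj zn n(2) by blast
  qed

  \<comment> \<open>The resulting bound for the determinant\<close>
  define d where "d = CARD('n)"
  have d: "d > 0" by (simp add: d_def)
  \<comment> \<open>The \<open>d\<close> sorted coordinates are indexed from 0 to \<open>m\<close>,
    so the factor \<open>m + 2\<close> is \<open>d + 1\<close>.\<close>
  define m where "m = d - 1"
  have m: "d = Suc m" using d by (simp add: m_def)
  obtain e :: "nat \<Rightarrow> 'n" where e: "bij_betw e {..<d} UNIV"
    "\<And>i. Suc i < d \<Longrightarrow> \<beta> $ e (Suc i) \<le> \<beta> $ e i"
    using ex_antimono_enumeration[of "\<lambda>i. \<beta> $ i"] unfolding d_def by blast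
  have bij_m: "bij_betw e {..m} UNIV" using e(1) unfolding m lessThan_Suc_atMost .
  have "1 \<le> real (m + 2) * real (sylv_prod m) ^ 2 * (\<Prod>i\<le>m. \<beta> $ e i)"
  proof (rule prod_ge_of_prod_le_remainder[where \<epsilon> = \<epsilon>])
    show "\<beta> $ e (Suc i) \<le> \<beta> $ e i" if "i < m" for i using e(2)[of i] that m by simp
    show "(\<Sum>i\<le>m. \<beta> $ e i) + \<epsilon> = 1"
      using sum.reindex_bij_betw[OF bij_m, of "\<lambda>i. \<beta> $ i"] \<beta>_sum by simp
    fix j assume j: "j \<le> m"
    have inj: "inj_on e {..<j}"
      using e(1) j m by (auto simp: bij_betw_def intro: inj_on_subset)
    show "(\<Prod>i<j. \<beta> $ e i - \<epsilon>) \<le> 1 - (\<Sum>i<j. \<beta> $ e i)"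
      using product[of "e ` {..<j}"] by (simp add: sum.reindex[OF inj] prod.reindex[OF inj])
  qed (use \<epsilon> \<beta>_ge in auto)
  also have "(\<Prod>i\<le>m. \<beta> $ e i) = (\<Prod>i\<in>UNIV. \<beta> $ i)"
    by (rule prod.reindex_bij_betw[OF bij_m])
  finally have "\<bar>det (matrix f)\<bar> * 1 \<le>
      \<bar>det (matrix f)\<bar> * (real (m + 2) * real (sylv_prod m) ^ 2 * (\<Prod>i\<in>UNIV. \<beta> $ i))"
    by (rule mult_left_mono) simp
  also have "\<dots> = real (m + 2) * real (sylv_prod m) ^ 2 * (\<bar>det (matrix f)\<bar> * (\<Prod>i\<in>UNIV. \<beta> $ i))"
    by (simp add: mult_ac)
  also have "\<dots> \<le> real (m + 2) * real (sylv_prod m) ^ 2 * real k"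
    using volume by (rule mult_left_mono) simp
  finally have det_le: "\<bar>det (matrix f)\<bar> \<le> real k * real (d + 1) * real (sylv_prod (d - 1)) ^ 2"
    using m by (simp add: mult_ac)

  \<comment> \<open>The simplex as an affine image of the standard simplex\<close>
  have f_axis: "f (axis i 1) = \<sigma> i - q" for i
    by (simp add: f_def axis_def if_distrib[of "\<lambda>c. c *\<^sub>R _"] cong: if_cong)
  have "V = insert q (range \<sigma>)" using \<sigma> q(1) by (auto simp: bij_betw_def)
  also have "\<dots> = (+) q ` f ` insert 0 Basis"
    by (auto simp: Basis_vec_def linear_0[OF lin] f_axis image_iff)
  finally have "convex hull V = (+) q ` f ` (convex hull (insert 0 Basis))"
    by (simp only: convex_hull_translation convex_hull_linear_image[OF lin])
  then have "measure lebesgue (convex hull V) = \<bar>det (matrix f)\<bar> * measure lebesgue (convex hull (insert 0 Basis) :: (real^'n) set)"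
    by (simp only: measure_translation)
      (intro measure_lebesgue_linear_image(2)[OF lin] lmeasurable_compact finite_imp_compact_convex_hull, simp)
  then show ?thesis
    using divide_right_mono[OF det_le, of "fact d"] by (simp add: measure_lebesgue_std_simplex d_def)
qed

text \<open>The bound on the maximum is expressed as a bound for every member of the family;
  \<open>sylvester d - 1\<close> unfolds to \<open>sylv_prod (d - 1)\<close>.\<close>

theorem theorem1p2:
  fixes d k :: nat
  assumes "CARD('n) = d" and "k \<ge> 1"
  shows "\<forall>S \<in> (simplices_with_interior_points k :: (real^'n) set set).
           measure lebesgue S \<le> real k * real (d + 1) * real ((sylvester d - 1)^2) / fact d"
  using lattice_simplex_volume_le[where ?'n = 'n] assms
  by (auto simp: simplices_with_interior_points_def lattice_simplex_def sylvester_def)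

end
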